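(* Let $n\in\mathbb{N}_+$ (a positive integer), $\alpha\in(n-1,n)$, $a<b$ real, and let $f,g:[a,b]\to\mathbb{R}$. (i) If $f$ can be expressed as a Taylor series (in the sense of the context) and $g$ is $n$ times continuously differentiable on $[a,b]$, then for every $t\in(a,b]$ $${}_a^{C}\mathscr{D}_t^\alpha\{f(t)g(t)\}=\sum_{j=0}^{+\infty}\binom{\alpha}{j}f^{(j)}(t)\,{}_a^{C}\mathscr{D}_t^{\alpha-j}g(t)+R_1,$$ where $$R_1=\sum_{k=0}^{n-1}\sum_{j=0}^{k}\left[\binom{\alpha}{j}f^{(j)}(t)-\binom{k}{j}f^{(j)}(a)\right]\frac{g^{(k-j)}(a)\,(t-a)^{k-\alpha}}{\Gamma(k+1-\alpha)}.$$ (ii) If $g$ can be expressed as a Taylor series (in the sense of the context) and $f$ is $n$ times continuously differentiable on $[a,b]$, then for every $t\in(a,b]$ $${}_a^{C}\mathscr{D}_t^\alpha\{f(t)g(t)\}=\sum_{j=0}^{+\infty}\binom{\alpha}{j}g^{(j)}(t)\,{}_a^{C}\mathscr{D}_t^{\alpha-j}f(t)+R_2,$$ where $$R_2=\sum_{k=0}^{n-1}\sum_{j=0}^{k}\left[\binom{\alpha}{j}g^{(j)}(t)-\binom{k}{j}g^{(j)}(a)\right]\frac{f^{(k-j)}(a)\,(t-a)^{k-\alpha}}{\Gamma(k+1-\alpha)}.$$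
   Context: For $\beta>0$ the Riemann--Liouville fractional integral with lower terminal $a$ is ${}_a^{R}\mathscr{I}_t^{\beta}h(t)=\frac{1}{\Gamma(\beta)}\int_a^t(t-\tau)^{\beta-1}h(\tau)\,d\tau$. For $m\in\mathbb{N}_+$ and $\beta\in(m-1,m)$ the Caputo derivative is ${}_a^{C}\mathscr{D}_t^{\beta}h(t)={}_a^{R}\mathscr{I}_t^{m-\beta}h^{(m)}(t)$. For negative order, the convention is ${}_a^{C}\mathscr{D}_t^{-\beta}h(t)={}_a^{R}\mathscr{I}_t^{\beta}h(t)$ for $\beta>0$; thus for $\alpha\in(n-1,n)$, ${}_a^{C}\mathscr{D}_t^{\alpha-j}$ is a genuine Caputo derivative of order $\alpha-j\in(n-j-1,n-j)$ for $0\le j\le n-1$, and equals ${}_a^{R}\mathscr{I}_t^{j-\alpha}$ for $j\ge n$. The generalized binomial coefficient is $\binom{\alpha}{j}=\frac{\alpha(\alpha-1)\cdots(\alpha-j+1)}{j!}$ with $\binom{\alpha}{0}=1$. "A function $h$ can be expressed as a Taylor series" means: $h$ is infinitely differentiable on $[a,b]$ and for each $t\in(a,b]$ one has the convergent expansion $h(\tau)=\sum_{k=0}^{+\infty}\frac{h^{(k)}(t)}{k!}(\tau-t)^k$ for all $\tau\in[a,t]$. All derivatives at end points are one-sided. *)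

theory Defs
  imports "HOL-Analysis.Analysis"
begin

text \<open>
  Real functions on \<open>[a,b]\<close> are total functions, of which only the values on \<open>{a..b}\<close> matter.
  All derivatives are taken within a set \<open>S\<close> (below always \<open>S = {a..b}\<close> with \<open>a < b\<close>), so they are
  one-sided at the end points.
\<close>

primrec nderiv_within :: "real set \<Rightarrow> nat \<Rightarrow> (real \<Rightarrow> real) \<Rightarrow> real \<Rightarrow> real" where
  "nderiv_within S 0 h = h"
| "nderiv_within S (Suc k) h = (\<lambda>x. vector_derivative (nderiv_within S k h) (at x within S))"

text \<open>\<open>vector_derivative\<close> is a total operator, so the existence of each derivative is demanded
  separately.\<close>

definition n_times_cont_diff_on :: "nat \<Rightarrow> real set \<Rightarrow> (real \<Rightarrow> real) \<Rightarrow> bool" where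
  "n_times_cont_diff_on n S h \<longleftrightarrow>
     (\<forall>k<n. nderiv_within S k h differentiable_on S) \<and> continuous_on S (nderiv_within S n h)"

definition infinitely_diff_on :: "real set \<Rightarrow> (real \<Rightarrow> real) \<Rightarrow> bool" where
  "infinitely_diff_on S h \<longleftrightarrow> (\<forall>k. nderiv_within S k h differentiable_on S)"

definition taylor_expressible_on :: "real \<Rightarrow> real \<Rightarrow> (real \<Rightarrow> real) \<Rightarrow> bool" where
  "taylor_expressible_on a b h \<longleftrightarrow>
     infinitely_diff_on {a..b} h \<and>
     (\<forall>t\<in>{a<..b}. \<forall>\<tau>\<in>{a..t}.
        (\<lambda>k. nderiv_within {a..b} k h t / fact k * (\<tau> - t) ^ k) sums h \<tau>)"

text \<open>Meant for \<open>\<beta> > 0\<close>. At \<open>\<tau> = t\<close> the kernel has the value \<open>0 powr (\<beta> - 1) = 0\<close>,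
  which does not affect the integral.\<close>

definition RL_integral :: "real \<Rightarrow> real \<Rightarrow> (real \<Rightarrow> real) \<Rightarrow> real \<Rightarrow> real" where
  "RL_integral a \<beta> h t = 1 / Gamma \<beta> * integral {a..t} (\<lambda>\<tau>. (t - \<tau>) powr (\<beta> - 1) * h \<tau>)"

text \<open>
  Caputo derivative of any non-integer order \<open>\<nu>\<close> and lower terminal \<open>a\<close> of a function on \<open>[a,b]\<close>,
  at \<open>t \<in> {a<..b}\<close>. For \<open>\<nu> > 0\<close>, \<open>m = \<lceil>\<nu>\<rceil>\<close> is the positive integer with \<open>\<nu> \<in> (m - 1, m)\<close>. For
  \<open>\<nu> < 0\<close> it is the fractional integral of order \<open>- \<nu>\<close>. Integer orders are outside the
  domain of the notion; at orders \<open>0, 1, 2, \<dots>\<close> the value below is meaningless.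
  The upper end \<open>b\<close> enters only through the set in which \<open>h\<close> is differentiated.
\<close>

definition caputo :: "real \<Rightarrow> real \<Rightarrow> real \<Rightarrow> (real \<Rightarrow> real) \<Rightarrow> real \<Rightarrow> real" where
  "caputo a b \<nu> h t =
     (if \<nu> < 0 then RL_integral a (- \<nu>) h t
      else let m = nat \<lceil>\<nu>\<rceil> in RL_integral a (real m - \<nu>) (nderiv_within {a..b} m h) t)"

text \<open>The correction term of the Leibniz rule for \<open>u v\<close> in which \<open>u\<close> carries the integer-order
  derivatives and \<open>v\<close> the fractional ones.\<close>

definition leibniz_remainder ::
  "real \<Rightarrow> real \<Rightarrow> nat \<Rightarrow> real \<Rightarrow> (real \<Rightarrow> real) \<Rightarrow> (real \<Rightarrow> real) \<Rightarrow> real \<Rightarrow> real" where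
  "leibniz_remainder a b n \<alpha> u v t =
     (\<Sum>k<n. \<Sum>j\<le>k.
        ((\<alpha> gchoose j) * nderiv_within {a..b} j u t
           - real (k choose j) * nderiv_within {a..b} j u a)
        * (nderiv_within {a..b} (k - j) v a * (t - a) powr (real k - \<alpha>)
             / Gamma (real k + 1 - \<alpha>)))"

end

theory Submission
  imports Defs
begin

text \<open>
  Adding the initial-value terms \<open>h\<^sup>(\<^sup>k\<^sup>)(a) (t - a)\<^sup>k\<^sup>-\<^sup>\<alpha> / \<Gamma>(k + 1 - \<alpha>)\<close>, \<open>k < n\<close>, to the Caputo derivative
  gives the Riemann--Liouville derivative, for which the Leibniz rule holds without remainder.
  Indeed, one integration by parts turns a factor \<open>x - t\<close> into a lowering of the order,
  \<open>D\<^sup>\<alpha>((x - t) g) = \<alpha> D\<^sup>\<alpha>\<^sup>-\<^sup>1 g\<close> at \<open>t\<close>; hence the \<open>j\<close>-th Taylor term of \<open>f\<close> at \<open>t\<close> contributes exactly the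
  \<open>j\<close>-th term of the series. What is left is the derivative of \<open>r\<^sub>N g\<close>, \<open>r\<^sub>N\<close> being the Taylor
  remainder. For \<open>N \<ge> n\<close> this function vanishes to order \<open>n\<close> at \<open>t\<close>, so that \<open>n\<close> integrations by
  parts without boundary terms at \<open>t\<close> express the derivative as the integral of
  \<open>(t - x)\<^sup>-\<^sup>\<alpha>\<^sup>-\<^sup>1 r\<^sub>N(x) g(x) / \<Gamma>(-\<alpha>)\<close>. It tends to \<open>0\<close> by dominated convergence: Abel summation bounds
  \<open>r\<^sub>N(x)\<close> by a multiple of \<open>(t - x)\<^sup>n\<close> uniformly in \<open>N\<close>, although the Taylor series need only
  converge conditionally at \<open>a\<close>.
\<close>

section \<open>Iterated derivatives within a compact interval\<close>

text \<open>The recursion differentiates on the outside. Inductions on the order that pass from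
  \<open>h\<close> to its derivative need the recursion on the inside.\<close>

lemma nderiv_within_Suc_shift:
  "nderiv_within S k (nderiv_within S (Suc 0) h) = nderiv_within S (Suc k) h"
  by (induction k) auto

lemma nderiv_within_has_derivative:
  assumes "n_times_cont_diff_on n S h" "k < n" "x \<in> S"
  shows "(nderiv_within S k h has_real_derivative nderiv_within S (Suc k) h x) (at x within S)"
  using assms
  by (auto simp: n_times_cont_diff_on_def differentiable_on_def vector_derivative_works
      has_real_derivative_iff_has_vector_derivative)

lemma continuous_on_nderiv_within:
  assumes "n_times_cont_diff_on n S h" "k \<le> n"
  shows "continuous_on S (nderiv_within S k h)"
  using assms
  by (cases "k = n") (auto simp: n_times_cont_diff_on_def intro: differentiable_imp_continuous_on)

lemma n_times_cont_diff_on_le: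
  assumes "n_times_cont_diff_on n S h" "m \<le> n"
  shows "n_times_cont_diff_on m S h"
  using assms continuous_on_nderiv_within[OF assms]
  by (auto simp: n_times_cont_diff_on_def)

lemma n_times_cont_diff_on_deriv:
  assumes "n_times_cont_diff_on (Suc n) S h"
  shows "n_times_cont_diff_on n S (nderiv_within S (Suc 0) h)"
  using assms unfolding n_times_cont_diff_on_def nderiv_within_Suc_shift by auto

lemma infinitely_diff_on_imp_n_times:
  assumes "infinitely_diff_on S h"
  shows "n_times_cont_diff_on n S h"
  using assms differentiable_imp_continuous_on
  by (auto simp: n_times_cont_diff_on_def infinitely_diff_on_def)

context
  fixes a b :: real and h :: "real \<Rightarrow> real" and H :: "nat \<Rightarrow> real \<Rightarrow> real" and n :: nat
  assumes ab: "a < b"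
    and H0: "\<And>x. x \<in> {a..b} \<Longrightarrow> h x = H 0 x"
    and HS: "\<And>k x. k < n \<Longrightarrow> x \<in> {a..b} \<Longrightarrow>
               (H k has_real_derivative H (Suc k) x) (at x within {a..b})"
begin

text \<open>Derivatives within a nondegenerate interval are unique, so a chain starting at
  \<open>h\<close> in which each function differentiates to the next must consist of the iterated
  derivatives. Each calculus rule below thus reduces to guessing a closed form \<open>H k\<close>
  and differentiating it once.\<close>

lemma nderiv_within_eqI:
  assumes "k \<le> n" "x \<in> {a..b}"
  shows "nderiv_within {a..b} k h x = H k x"
  using assms
proof (induction k arbitrary: x)
  case 0
  then show ?case by (simp add: H0)
next
  case (Suc k)
  have "(H k has_vector_derivative H (Suc k) x) (at x within {a..b})"
    using HS[of k x] Suc.prems by (simp add: has_real_derivative_iff_has_vector_derivative)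
  then have "(nderiv_within {a..b} k h has_vector_derivative H (Suc k) x) (at x within {a..b})"
    by (rule has_vector_derivative_transform[rotated 2]) (use Suc in auto)
  then show ?case
    using vector_derivative_within_closed_interval[OF ab, of x] Suc.prems by auto
qed

lemma n_times_cont_diff_onI:
  assumes "continuous_on {a..b} (H n)"
  shows "n_times_cont_diff_on n {a..b} h"
  unfolding n_times_cont_diff_on_def
proof (intro conjI allI impI)
  fix k assume k: "k < n"
  show "nderiv_within {a..b} k h differentiable_on {a..b}"
    unfolding differentiable_on_def
  proof
    fix x assume x: "x \<in> {a..b}"
    have "(H k has_vector_derivative H (Suc k) x) (at x within {a..b})"
      using HS[OF k x] by (simp add: has_real_derivative_iff_has_vector_derivative)
    then have "(nderiv_within {a..b} k h has_vector_derivative H (Suc k) x) (at x within {a..b})"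
      by (rule has_vector_derivative_transform[rotated 2]) (use nderiv_within_eqI k x in auto)
    then show "nderiv_within {a..b} k h differentiable (at x within {a..b})"
      by (auto simp: has_vector_derivative_def differentiable_def)
  qed
next
  show "continuous_on {a..b} (nderiv_within {a..b} n h)"
    using assms by (rule continuous_on_eq) (use nderiv_within_eqI in auto)
qed

end

section \<open>Iterated derivatives of sums, products and Taylor polynomials\<close>

lemma nderiv_within_lincomb:
  fixes a b c :: real
  assumes "a < b" "n_times_cont_diff_on n {a..b} u" "n_times_cont_diff_on n {a..b} v"
  shows "n_times_cont_diff_on n {a..b} (\<lambda>x. c * u x + v x)"
    and "k \<le> n \<Longrightarrow> x \<in> {a..b} \<Longrightarrow> nderiv_within {a..b} k (\<lambda>x. c * u x + v x) x =
           c * nderiv_within {a..b} k u x + nderiv_within {a..b} k v x"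
proof -
  define H where "H k x = c * nderiv_within {a..b} k u x + nderiv_within {a..b} k v x" for k x
  have H: "(H k has_real_derivative H (Suc k) x) (at x within {a..b})"
    if "k < n" "x \<in> {a..b}" for k x
    unfolding H_def
    by (intro DERIV_add DERIV_cmult nderiv_within_has_derivative[OF assms(2)]
        nderiv_within_has_derivative[OF assms(3)] that)
  have "continuous_on {a..b} (H n)"
    unfolding H_def by (intro continuous_intros continuous_on_nderiv_within[OF assms(2)]
        continuous_on_nderiv_within[OF assms(3)]) auto
  with H show "n_times_cont_diff_on n {a..b} (\<lambda>x. c * u x + v x)"
    by (intro n_times_cont_diff_onI[OF \<open>a < b\<close>, where H = H]) (auto simp: H_def)
  show "nderiv_within {a..b} k (\<lambda>x. c * u x + v x) x =
          c * nderiv_within {a..b} k u x + nderiv_within {a..b} k v x"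
    if "k \<le> n" "x \<in> {a..b}"
    using nderiv_within_eqI[OF \<open>a < b\<close>, of "\<lambda>x. c * u x + v x" H, OF _ H, OF _ _ _ that]
    by (simp add: H_def)
qed

lemma nderiv_within_linear_factor:
  fixes a b t :: real
  assumes "a < b" "n_times_cont_diff_on n {a..b} g"
  shows "n_times_cont_diff_on n {a..b} (\<lambda>x. (x - t) * g x)"
    and "k \<le> n \<Longrightarrow> x \<in> {a..b} \<Longrightarrow> nderiv_within {a..b} k (\<lambda>x. (x - t) * g x) x =
           (x - t) * nderiv_within {a..b} k g x + real k * nderiv_within {a..b} (k - 1) g x"
proof -
  define H where
    "H k x = (x - t) * nderiv_within {a..b} k g x + real k * nderiv_within {a..b} (k - 1) g x"
    for k x
  have H: "(H k has_real_derivative H (Suc k) x) (at x within {a..b})"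
    if "k < n" "x \<in> {a..b}" for k x
  proof -
    have 1: "((\<lambda>x. (x - t) * nderiv_within {a..b} k g x) has_real_derivative
        1 * nderiv_within {a..b} k g x + nderiv_within {a..b} (Suc k) g x * (x - t))
        (at x within {a..b})"
      by (intro DERIV_mult nderiv_within_has_derivative[OF assms(2)] that) 
        (auto intro!: derivative_eq_intros)
    \<comment> \<open>The case \<open>k = 0\<close> is separate: there \<open>k - 1\<close> is again
      \<open>0\<close>, and the term vanishes through its coefficient \<open>real k\<close>.\<close>
    have 2: "((\<lambda>x. real k * nderiv_within {a..b} (k - 1) g x) has_real_derivative
        real k * nderiv_within {a..b} k g x) (at x within {a..b})"
    proof (cases k)
      case (Suc m)
      then show ?thesis
        using DERIV_cmult[OF nderiv_within_has_derivative[OF assms(2), of m x], of "real k"] that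
        by simp
    qed simp
    show ?thesis
      unfolding H_def using DERIV_add[OF 1 2] by (simp add: algebra_simps del: nderiv_within.simps)
  qed
  have "continuous_on {a..b} (H n)"
    unfolding H_def by (intro continuous_intros continuous_on_nderiv_within[OF assms(2)]) auto
  with H show "n_times_cont_diff_on n {a..b} (\<lambda>x. (x - t) * g x)"
    by (intro n_times_cont_diff_onI[OF \<open>a < b\<close>, where H = H]) (auto simp: H_def)
  show "nderiv_within {a..b} k (\<lambda>x. (x - t) * g x) x =
      (x - t) * nderiv_within {a..b} k g x + real k * nderiv_within {a..b} (k - 1) g x"
    if "k \<le> n" "x \<in> {a..b}"
    using nderiv_within_eqI[OF \<open>a < b\<close>, of "\<lambda>x. (x - t) * g x" H, OF _ H, OF _ _ _ that]
    by (simp add: H_def)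
qed

lemma n_times_cont_diff_on_power_factor:
  fixes a b t :: real
  assumes "a < b" "n_times_cont_diff_on n {a..b} g"
  shows "n_times_cont_diff_on n {a..b} (\<lambda>x. (x - t) ^ j * g x)"
proof (induction j)
  case (Suc j)
  from nderiv_within_linear_factor(1)[OF assms(1) this, of t] show ?case
    by (simp add: mult.assoc)
qed (use assms in simp)

text \<open>Pascal's rule in the shape in which differentiating a binomial sum produces it:
  \<open>\<phi> i l\<close> stands for the \<open>i\<close>-th derivative of one factor times the
  \<open>l\<close>-th derivative of the other.\<close>

lemma sum_choose_Suc:
  fixes \<phi> :: "nat \<Rightarrow> nat \<Rightarrow> real"
  shows "(\<Sum>i\<le>k. real (k choose i) * (\<phi> (Suc i) (k - i) + \<phi> i (Suc k - i))) =
         (\<Sum>i\<le>Suc k. real (Suc k choose i) * \<phi> i (Suc k - i))"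
proof -
  have "(\<Sum>i\<le>k. real (k choose i) * \<phi> i (Suc k - i)) =
        (\<Sum>i\<le>Suc k. real (k choose i) * \<phi> i (Suc k - i))"
    by simp
  also have "\<dots> = \<phi> 0 (Suc k) + (\<Sum>i\<le>k. real (k choose Suc i) * \<phi> (Suc i) (k - i))"
    by (subst sum.atMost_Suc_shift) simp
  finally have *: "(\<Sum>i\<le>k. real (k choose i) * \<phi> i (Suc k - i)) =
    \<phi> 0 (Suc k) + (\<Sum>i\<le>k. real (k choose Suc i) * \<phi> (Suc i) (k - i))" .
  show ?thesis
    by (subst sum.atMost_Suc_shift) (simp add: distrib_left sum.distrib * distrib_right)
qed

lemma nderiv_within_mult:
  fixes a b :: real
  assumes "a < b" "n_times_cont_diff_on n {a..b} u" "n_times_cont_diff_on n {a..b} v"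
  shows "n_times_cont_diff_on n {a..b} (\<lambda>x. u x * v x)"
    and "k \<le> n \<Longrightarrow> x \<in> {a..b} \<Longrightarrow> nderiv_within {a..b} k (\<lambda>x. u x * v x) x =
           (\<Sum>i\<le>k. real (k choose i) *
              (nderiv_within {a..b} i u x * nderiv_within {a..b} (k - i) v x))"
proof -
  define H where "H k x = (\<Sum>i\<le>k. real (k choose i) *
      (nderiv_within {a..b} i u x * nderiv_within {a..b} (k - i) v x))" for k x
  have H: "(H k has_real_derivative H (Suc k) x) (at x within {a..b})"
    if "k < n" "x \<in> {a..b}" for k x
  proof -
    have "(H k has_real_derivative (\<Sum>i\<le>k. real (k choose i) *
        (nderiv_within {a..b} (Suc i) u x * nderiv_within {a..b} (k - i) v x +
         nderiv_within {a..b} (Suc (k - i)) v x * nderiv_within {a..b} i u x)))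
        (at x within {a..b})"
      unfolding H_def
      by (intro DERIV_sum DERIV_cmult DERIV_mult nderiv_within_has_derivative[OF assms(2)]
          nderiv_within_has_derivative[OF assms(3)]) (use that in auto)
    also have "(\<Sum>i\<le>k. real (k choose i) *
        (nderiv_within {a..b} (Suc i) u x * nderiv_within {a..b} (k - i) v x +
         nderiv_within {a..b} (Suc (k - i)) v x * nderiv_within {a..b} i u x)) = H (Suc k) x"
      unfolding H_def
      by (subst sum_choose_Suc[symmetric], rule sum.cong)
        (auto simp: Suc_diff_le mult.commute simp del: nderiv_within.simps)
    finally show ?thesis .
  qed
  have "continuous_on {a..b} (H n)"
    unfolding H_def by (intro continuous_intros continuous_on_nderiv_within[OF assms(2)]
        continuous_on_nderiv_within[OF assms(3)]) auto
  with H show "n_times_cont_diff_on n {a..b} (\<lambda>x. u x * v x)"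
    by (intro n_times_cont_diff_onI[OF \<open>a < b\<close>, where H = H]) (auto simp: H_def)
  show "nderiv_within {a..b} k (\<lambda>x. u x * v x) x = (\<Sum>i\<le>k. real (k choose i) *
      (nderiv_within {a..b} i u x * nderiv_within {a..b} (k - i) v x))"
    if "k \<le> n" "x \<in> {a..b}"
    using nderiv_within_eqI[OF \<open>a < b\<close>, of "\<lambda>x. u x * v x" H, OF _ H, OF _ _ _ that]
    by (simp add: H_def)
qed

text \<open>\<open>N\<close> counts terms, so the degree is below \<open>N\<close>. For
  \<open>N = 0\<close> the polynomial is zero and the remainder is \<open>f\<close> itself, which is
  where the telescoping in \<open>rl_deriv_leibniz_sums\<close> starts.\<close>

definition taylor_poly :: "real \<Rightarrow> real \<Rightarrow> nat \<Rightarrow> (real \<Rightarrow> real) \<Rightarrow> real \<Rightarrow> real \<Rightarrow> real" where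
  "taylor_poly a b N f t x = (\<Sum>j<N. nderiv_within {a..b} j f t / fact j * (x - t) ^ j)"

lemma nderiv_within_taylor_poly:
  fixes a b t :: real
  assumes "a < b"
  shows "n_times_cont_diff_on n {a..b} (taylor_poly a b N f t)"
    and "k < N \<Longrightarrow> t \<in> {a..b} \<Longrightarrow>
           nderiv_within {a..b} k (taylor_poly a b N f t) t = nderiv_within {a..b} k f t"
proof -
  \<comment> \<open>Differentiation shifts the Taylor coefficients; the truncated
    \<open>N - k\<close> makes the derivative zero once \<open>k\<close> reaches
    \<open>N\<close>.\<close>
  define H where
    "H k x = (\<Sum>j<N - k. nderiv_within {a..b} (j + k) f t / fact j * (x - t) ^ j)" for k x
  have H: "(H k has_real_derivative H (Suc k) x) (at x within {a..b})" for k x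
  proof -
    have "(H k has_real_derivative (\<Sum>j<N - k. nderiv_within {a..b} (j + k) f t / fact j *
        (real j * (x - t) ^ (j - 1)))) (at x within {a..b})"
      unfolding H_def
      by (intro DERIV_sum DERIV_cmult) (auto intro!: derivative_eq_intros)
    also have "(\<Sum>j<N - k. nderiv_within {a..b} (j + k) f t / fact j * (real j * (x - t) ^ (j - 1)))
        = H (Suc k) x"
    proof (cases "N - k")
      case (Suc m)
      then have m: "N - Suc k = m" by simp
      show ?thesis
        unfolding H_def Suc m
        by (subst sum.lessThan_Suc_shift) (auto intro!: sum.cong simp: field_simps simp del: nderiv_within.simps of_nat_Suc)
    qed (simp add: H_def)
    finally show ?thesis .
  qed
  have H0: "taylor_poly a b N f t x = H 0 x" for x
    by (simp add: taylor_poly_def H_def)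
  have "continuous_on {a..b} (H n)"
    unfolding H_def by (intro continuous_intros)
  with H show "n_times_cont_diff_on n {a..b} (taylor_poly a b N f t)"
    by (intro n_times_cont_diff_onI[OF \<open>a < b\<close>, where H = H]) (auto simp: H0)
  show "nderiv_within {a..b} k (taylor_poly a b N f t) t = nderiv_within {a..b} k f t"
    if "k < N" "t \<in> {a..b}"
  proof -
    obtain m where m: "N - k = Suc m" using \<open>k < N\<close> by (metis Suc_diff_Suc)
    have "nderiv_within {a..b} k (taylor_poly a b N f t) t = H k t"
      by (rule nderiv_within_eqI[OF \<open>a < b\<close>, where n = N]) (use that H0 H in auto)
    also have "\<dots> = nderiv_within {a..b} k f t"
      unfolding H_def m by (subst sum.lessThan_Suc_shift) simp
    finally show ?thesis .
  qed
qed

text \<open>By induction the derivative is bounded by \<open>C * (t - x) ^ n\<close>. Since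
  \<open>h t = 0\<close>, the mean value inequality on \<open>{x..t}\<close> gains one factor
  \<open>t - x\<close> with the same constant.\<close>

lemma vanishing_derivatives_bound:
  fixes a b t :: real
  assumes "a < t" "t \<le> b" "n_times_cont_diff_on n {a..b} h"
    and "\<And>k. k < n \<Longrightarrow> nderiv_within {a..b} k h t = 0"
  shows "\<exists>C. \<forall>x\<in>{a..t}. \<bar>h x\<bar> \<le> C * (t - x) ^ n"
  using assms(3,4)
proof (induction n arbitrary: h)
  case 0
  then have "continuous_on {a..t} h"
    using continuous_on_nderiv_within[of 0 "{a..b}" h 0] \<open>t \<le> b\<close>
    by (auto intro: continuous_on_subset)
  then have "bounded (h ` {a..t})"
    by (intro compact_imp_bounded compact_continuous_image) auto
  then show ?case
    by (auto simp: bounded_iff)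
next
  case (Suc n)
  let ?h' = "nderiv_within {a..b} (Suc 0) h"
  have "\<exists>C. \<forall>x\<in>{a..t}. \<bar>?h' x\<bar> \<le> C * (t - x) ^ n"
    using Suc.prems by (intro Suc.IH n_times_cont_diff_on_deriv)
      (auto simp: nderiv_within_Suc_shift simp del: nderiv_within.simps)
  then obtain C where C: "\<bar>?h' x\<bar> \<le> C * (t - x) ^ n" if "x \<in> {a..t}" for x
    by blast
  \<comment> \<open>The bound at \<open>a\<close> forces \<open>C \<ge> 0\<close>, so that on
    \<open>{x..t}\<close> the bound is largest at \<open>x\<close>.\<close>
  have "0 \<le> C * (t - a) ^ n"
    using C[of a] \<open>a < t\<close> abs_ge_zero order_trans by fastforce
  moreover have "0 < (t - a) ^ n"
    using \<open>a < t\<close> by simp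
  ultimately have "C \<ge> 0"
    by (simp add: zero_le_mult_iff)
  have "\<bar>h x\<bar> \<le> C * (t - x) ^ Suc n" if x: "x \<in> {a..t}" for x
  proof -
    have "norm (h t - h x) \<le> C * (t - x) ^ n * norm (t - x)"
    proof (rule field_differentiable_bound[where S = "{x..t}" and f' = ?h'])
      fix y assume y: "y \<in> {x..t}"
      have "(h has_real_derivative ?h' y) (at y within {a..b})"
        using nderiv_within_has_derivative[OF Suc.prems(1), of 0 y] x y \<open>t \<le> b\<close> by auto
      then show "(h has_real_derivative ?h' y) (at y within {x..t})"
        by (rule DERIV_subset) (use x \<open>t \<le> b\<close> in auto)
      have "C * (t - y) ^ n \<le> C * (t - x) ^ n"
        using y \<open>C \<ge> 0\<close> by (intro mult_left_mono power_mono) auto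
      then show "norm (?h' y) \<le> C * (t - x) ^ n"
        using C[of y] x y by auto
    qed (use x in auto)
    moreover have "h t = 0"
      using Suc.prems(2)[of 0] by simp
    ultimately show ?thesis
      using x by (simp add: mult_ac)
  qed
  then show ?case by blast
qed

section \<open>Integrals against the singular kernel\<close>

text \<open>For \<open>p > -1\<close> the kernel has an antiderivative continuous up to
  \<open>t\<close>. Being nonnegative, the kernel is then absolutely integrable, and a bounded
  measurable factor preserves this.\<close>

lemma powr_kernel_integrable:
  fixes a t p :: real
  assumes "a \<le> t" "p > -1" "continuous_on {a..t} \<phi>"
  shows "(\<lambda>x. (t - x) powr p * \<phi> x) integrable_on {a..t}"
proof -
  have "((\<lambda>x. (t - x) powr p) has_integral
      (- ((t - t) powr (p + 1) / (p + 1)) - - ((t - a) powr (p + 1) / (p + 1)))) {a..t}"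
  proof (rule fundamental_theorem_of_calculus_interior)
    show "continuous_on {a..t} (\<lambda>x. - ((t - x) powr (p + 1) / (p + 1)))"
      by (intro continuous_intros continuous_on_powr') (use \<open>p > -1\<close> in auto)
    fix x assume "x \<in> {a<..<t}"
    then have "((\<lambda>x. - ((t - x) powr (p + 1) / (p + 1))) has_real_derivative (t - x) powr p) (at x)"
      using \<open>p > -1\<close> by (auto intro!: derivative_eq_intros)
    then show "((\<lambda>x. - ((t - x) powr (p + 1) / (p + 1))) has_vector_derivative (t - x) powr p) (at x)"
      by (simp add: has_real_derivative_iff_has_vector_derivative)
  qed (use \<open>a \<le> t\<close> in auto)
  then have "(\<lambda>x. (t - x) powr p) absolutely_integrable_on {a..t}"
    by (intro nonnegative_absolutely_integrable_1) (auto simp: integrable_on_def)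
  moreover have "bounded (\<phi> ` {a..t})"
    using assms by (intro compact_imp_bounded compact_continuous_image) auto
  ultimately have "(\<lambda>x. \<phi> x * (t - x) powr p) absolutely_integrable_on {a..t}"
    using assms
    by (intro absolutely_integrable_bounded_measurable_product_real
        continuous_imp_measurable_on_sets_lebesgue) auto
  then show ?thesis
    by (simp add: absolutely_integrable_on_def mult.commute)
qed

text \<open>Here \<open>p\<close> may be negative. At \<open>t\<close> the product has the value
  \<open>0\<close>, since \<open>0 powr p = 0\<close>, and near \<open>t\<close> it is squeezed by
  \<open>C * (t - x) powr (p + real m)\<close>, which tends to \<open>0\<close>.\<close>

lemma powr_kernel_continuous:
  fixes a t p :: real
  assumes "a < t" "continuous_on {a..t} h"
    and bound: "\<And>x. x \<in> {a..t} \<Longrightarrow> \<bar>h x\<bar> \<le> C * (t - x) ^ m"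
    and "p + real m > 0"
  shows "continuous_on {a..t} (\<lambda>x. (t - x) powr p * h x)"
  unfolding continuous_on_def
proof
  fix x assume x: "x \<in> {a..t}"
  show "((\<lambda>x. (t - x) powr p * h x) \<longlongrightarrow> (t - x) powr p * h x) (at x within {a..t})"
  proof (cases "x = t")
    case False
    then show ?thesis
      using x \<open>continuous_on {a..t} h\<close>
      by (intro tendsto_intros) (auto simp: continuous_on_def)
  next
    case True
    have "continuous_on {a..t} (\<lambda>x. C * (t - x) powr (p + real m))"
      by (intro continuous_intros continuous_on_powr') (use assms in auto)
    then have "((\<lambda>x. C * (t - x) powr (p + real m)) \<longlongrightarrow> C * (t - t) powr (p + real m))
        (at t within {a..t})"
      using \<open>a < t\<close> unfolding continuous_on_def by (metis atLeastAtMost_iff less_eq_real_def)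
    then have lim: "((\<lambda>x. C * (t - x) powr (p + real m)) \<longlongrightarrow> 0) (at t within {a..t})"
      by simp
    have "\<forall>\<^sub>F x in at t within {a..t}. norm ((t - x) powr p * h x) \<le> C * (t - x) powr (p + real m)"
      unfolding eventually_at_filter
    proof (rule always_eventually, intro allI impI)
      fix y assume y: "y \<noteq> t" "y \<in> {a..t}"
      have "norm ((t - y) powr p * h y) \<le> (t - y) powr p * (C * (t - y) ^ m)"
        using bound[OF y(2)] by (simp add: abs_mult mult_left_mono)
      also have "\<dots> = C * (t - y) powr (p + real m)"
        using y by (simp add: powr_add powr_realpow)
      finally show "norm ((t - y) powr p * h y) \<le> C * (t - y) powr (p + real m)" .
    qed
    from Lim_null_comparison[OF this lim] show ?thesis
      using True by simp
  qed
qed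

text \<open>The two integrals are kept in one integrand so that neither has to exist in advance. The
  boundary term at \<open>t\<close> drops out because \<open>0 powr p = 0\<close>; the assumed
  continuity of the product makes this value its limit at \<open>t\<close>.\<close>

lemma powr_kernel_by_parts:
  fixes a t p :: real
  assumes "a \<le> t" "continuous_on {a..t} (\<lambda>x. (t - x) powr p * h x)"
    and deriv: "\<And>x. x \<in> {a<..<t} \<Longrightarrow> (h has_real_derivative h' x) (at x)"
  shows "((\<lambda>x. (t - x) powr p * h' x - p * ((t - x) powr (p - 1) * h x)) has_integral
           - ((t - a) powr p * h a)) {a..t}"
proof -
  have "((\<lambda>x. (t - x) powr p * h' x - p * ((t - x) powr (p - 1) * h x)) has_integral
      (t - t) powr p * h t - (t - a) powr p * h a) {a..t}"
  proof (rule fundamental_theorem_of_calculus_interior)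
    fix x assume x: "x \<in> {a<..<t}"
    have "((\<lambda>x. (t - x) powr p * h x) has_real_derivative
        (t - x) powr p * h' x - p * ((t - x) powr (p - 1) * h x)) (at x)"
      using x by (auto intro!: derivative_eq_intros deriv)
    then show "((\<lambda>x. (t - x) powr p * h x) has_vector_derivative
        (t - x) powr p * h' x - p * ((t - x) powr (p - 1) * h x)) (at x)"
      by (simp add: has_real_derivative_iff_has_vector_derivative)
  qed (use assms in auto)
  then show ?thesis by simp
qed

lemma nderiv_within_has_derivative_at:
  fixes a b t x :: real
  assumes "n_times_cont_diff_on n {a..b} h" "k < n" "x \<in> {a<..<t}" "t \<le> b"
  shows "(nderiv_within {a..b} k h has_real_derivative nderiv_within {a..b} (Suc k) h x) (at x)"
  using nderiv_within_has_derivative[OF assms(1,2), of x] assms(3,4)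
  by (simp add: at_within_Icc_at)

lemma continuous_on_nderiv_within_initial:
  fixes a b t :: real
  assumes "n_times_cont_diff_on n {a..b} h" "k \<le> n" "t \<le> b"
  shows "continuous_on {a..t} (nderiv_within {a..b} k h)"
  by (rule continuous_on_subset[OF continuous_on_nderiv_within[OF assms(1,2)]]) (use assms in auto)

section \<open>The Riemann--Liouville derivative\<close>

text \<open>The Caputo derivative together with the terms by which the Riemann--Liouville derivative
  differs from it; unlike the Caputo derivative it satisfies a Leibniz rule without remainder.\<close>

definition rl_deriv :: "real \<Rightarrow> real \<Rightarrow> nat \<Rightarrow> real \<Rightarrow> (real \<Rightarrow> real) \<Rightarrow> real \<Rightarrow> real" where
  "rl_deriv a b n \<alpha> h t =
     RL_integral a (real n - \<alpha>) (nderiv_within {a..b} n h) t +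
     (\<Sum>k<n. nderiv_within {a..b} k h a * ((t - a) powr (real k - \<alpha>) / Gamma (real k + 1 - \<alpha>)))"

lemma rl_deriv_lincomb:
  fixes a b c t \<alpha> :: real
  assumes "a < t" "t \<le> b" "\<alpha> < real n"
    and u: "n_times_cont_diff_on n {a..b} u" and v: "n_times_cont_diff_on n {a..b} v"
  shows "rl_deriv a b n \<alpha> (\<lambda>x. c * u x + v x) t = c * rl_deriv a b n \<alpha> u t + rl_deriv a b n \<alpha> v t"
proof -
  let ?D = "nderiv_within {a..b}"
  let ?K = "\<lambda>x. (t - x) powr (real n - \<alpha> - 1)"
  have ab: "a < b" using assms by simp
  note D = nderiv_within_lincomb(2)[OF ab u v, of _ _ c]
  have int: "(\<lambda>x. ?K x * ?D n w x) integrable_on {a..t}" if "n_times_cont_diff_on n {a..b} w" for w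
    by (rule powr_kernel_integrable) (use assms that continuous_on_nderiv_within_initial in auto)
  have "integral {a..t} (\<lambda>x. ?K x * ?D n (\<lambda>x. c * u x + v x) x) =
        integral {a..t} (\<lambda>x. c * (?K x * ?D n u x) + ?K x * ?D n v x)"
    using D[of n] \<open>t \<le> b\<close> by (intro integral_cong) (simp add: algebra_simps)
  also have "\<dots> = c * integral {a..t} (\<lambda>x. ?K x * ?D n u x) + integral {a..t} (\<lambda>x. ?K x * ?D n v x)"
    using int[OF u] int[OF v]
    by (simp add: integral_add integrable_on_mult_right)
  finally have 1: "RL_integral a (real n - \<alpha>) (?D n (\<lambda>x. c * u x + v x)) t =
      c * RL_integral a (real n - \<alpha>) (?D n u) t + RL_integral a (real n - \<alpha>) (?D n v) t"
    by (simp add: RL_integral_def distrib_left add_divide_distrib)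
  have 2: "(\<Sum>k<n. ?D k (\<lambda>x. c * u x + v x) a * w k) =
      c * (\<Sum>k<n. ?D k u a * w k) + (\<Sum>k<n. ?D k v a * w k)" for w :: "nat \<Rightarrow> real"
    unfolding sum_distrib_left sum.distrib[symmetric]
    by (rule sum.cong) (use D[of _ a] ab in \<open>auto simp: algebra_simps\<close>)
  show ?thesis
    unfolding rl_deriv_def 1 2 by (simp add: algebra_simps)
qed

section \<open>How a factor \<open>x - t\<close> lowers the order\<close>

lemma Gamma_plus1_non_Int:
  fixes x :: real
  assumes "x \<notin> \<int>"
  shows "Gamma (x + 1) = x * Gamma x" "Gamma x \<noteq> 0"
  using assms nonpos_Ints_subset_Ints by (auto intro!: Gamma_plus1 simp: Gamma_eq_zero_iff)

lemma shift_non_Int: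
  fixes \<alpha> :: real
  assumes "\<alpha> \<notin> \<int>"
  shows "real k + 1 - \<alpha> \<notin> \<int>" "\<alpha> - 1 \<notin> \<int>" "- \<alpha> \<notin> \<int>"
proof -
  show "real k + 1 - \<alpha> \<notin> \<int>"
    using assms Ints_diff[of "real (Suc k)" "real k + 1 - \<alpha>"] by auto
  show "\<alpha> - 1 \<notin> \<int>"
    using assms Ints_add[of "\<alpha> - 1" 1] by auto
  show "- \<alpha> \<notin> \<int>"
    using assms by simp
qed

text \<open>With \<open>d k\<close> the \<open>k\<close>-th derivative of \<open>g\<close> at
  \<open>a\<close> and \<open>x = t - a\<close>, the left side collects the initial terms of the
  product of \<open>g\<close> with the linear factor. The surplus term on the right cancels the
  boundary term at \<open>a\<close> from the integration by parts in
  \<open>rl_deriv_linear_factor\<close>.\<close>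

lemma initial_terms_linear_factor:
  fixes d :: "nat \<Rightarrow> real" and x \<alpha> :: real
  assumes "x > 0" "\<alpha> \<notin> \<int>"
  shows "(\<Sum>k<Suc m. (- x * d k + real k * d (k - 1)) * (x powr (real k - \<alpha>) / Gamma (real k + 1 - \<alpha>)))
       = \<alpha> * (\<Sum>k<m. d k * (x powr (real k - (\<alpha> - 1)) / Gamma (real k + 1 - (\<alpha> - 1))))
         - d m * (x powr (real (Suc m) - \<alpha>) / Gamma (real (Suc m) - \<alpha>))"
proof -
  define F where "F k = (- x * d k + real k * d (k - 1)) * (x powr (real k - \<alpha>) / Gamma (real k + 1 - \<alpha>))" for k
  define G where "G k = d k * (x powr (real k - (\<alpha> - 1)) / Gamma (real k + 1 - (\<alpha> - 1)))" for k
  define Q where "Q k = d k * (x powr (real (Suc k) - \<alpha>) / Gamma (real (Suc k) - \<alpha>))" for k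
  \<comment> \<open>For \<open>z = k + 1 - \<alpha>\<close>, the rule Gamma(z + 1) = z Gamma(z)
    gives \<open>Q k\<close> the denominator of \<open>F (Suc k)\<close> and the coefficient
    \<open>z\<close>. As \<open>k + 1 = z + \<alpha>\<close>, subtracting it leaves the coefficient
    \<alpha>.\<close>
  have step: "F (Suc k) - Q k = \<alpha> * G k - Q (Suc k)" for k
  proof -
    define z where "z = real k + 1 - \<alpha>"
    have z: "Gamma (z + 1) = z * Gamma z" "Gamma z \<noteq> 0"
      unfolding z_def using Gamma_plus1_non_Int shift_non_Int(1)[OF assms(2)] by blast+
    have "z \<noteq> 0" using shift_non_Int(1)[OF assms(2), of k] unfolding z_def by auto
    have "real (Suc k) - \<alpha> = z" "real (Suc k) + 1 - \<alpha> = z + 1" "real k - (\<alpha> - 1) = z"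
      "real k + 1 - (\<alpha> - 1) = z + 1" "real (Suc (Suc k)) - \<alpha> = z + 1" "real (Suc k) = z + \<alpha>"
      by (auto simp: z_def)
    moreover have "x powr (z + 1) = x * x powr z"
      using \<open>x > 0\<close> by (simp add: powr_add)
    ultimately show ?thesis
      unfolding F_def G_def Q_def diff_Suc_1
      using z \<open>z \<noteq> 0\<close> by (simp add: field_simps)
  qed
  have "(\<Sum>k<Suc m. F k) = \<alpha> * (\<Sum>k<m. G k) - Q m"
  proof (induction m)
    case 0
    show ?case
      using \<open>x > 0\<close> by (simp add: F_def Q_def powr_diff powr_minus divide_inverse)
  next
    case (Suc m)
    have "(\<Sum>k<Suc (Suc m). F k) = \<alpha> * (\<Sum>k<m. G k) - Q m + F (Suc m)"
      using Suc.IH by simp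
    also have "\<dots> = \<alpha> * (\<Sum>k<Suc m. G k) - Q (Suc m)"
      using step[of m] by (simp add: distrib_left)
    finally show ?case .
  qed
  then show ?thesis
    by (simp only: F_def G_def Q_def)
qed

lemma rl_deriv_linear_factor:
  fixes a b t \<alpha> :: real
  assumes at: "a < t" "t \<le> b" and \<alpha>: "\<alpha> \<notin> \<int>" "\<alpha> < real n" and g: "n_times_cont_diff_on n {a..b} g"
  shows "rl_deriv a b n \<alpha> (\<lambda>x. (x - t) * g x) t = \<alpha> * rl_deriv a b (n - 1) (\<alpha> - 1) g t"
proof (cases n)
  case 0
  \<comment> \<open>Without derivatives both sides are fractional integrals: the linear factor
    raises the kernel exponent by one, and Gamma(1 - \<alpha>) = -\<alpha> Gamma(-\<alpha>) supplies
    the factor \<alpha>.\<close>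
  have "integral {a..t} (\<lambda>x. (t - x) powr (- \<alpha> - 1) * ((x - t) * g x)) =
        integral {a..t} (\<lambda>x. - ((t - x) powr (- \<alpha>) * g x))"
  proof (rule integral_cong)
    fix x assume "x \<in> {a..t}"
    then show "(t - x) powr (- \<alpha> - 1) * ((x - t) * g x) = - ((t - x) powr (- \<alpha>) * g x)"
      by (cases "x = t") (auto simp: powr_diff field_simps)
  qed
  moreover have "Gamma (- \<alpha> + 1) = - \<alpha> * Gamma (- \<alpha>)" "Gamma (- \<alpha>) \<noteq> 0"
    using Gamma_plus1_non_Int shift_non_Int(3)[OF \<alpha>(1)] by blast+
  moreover have "\<alpha> \<noteq> 0" using \<alpha>(1) by auto
  ultimately show ?thesis
    using 0 by (simp add: rl_deriv_def RL_integral_def field_simps)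
next
  case (Suc m)
  let ?D = "nderiv_within {a..b}"
  define p where "p = real n - \<alpha>"
  have ab: "a < b" and p: "p > 0" using assms by (auto simp: p_def)
  define I1 where "I1 = integral {a..t} (\<lambda>x. (t - x) powr (p - 1) * ?D m g x)"
  define I0 where "I0 = integral {a..t} (\<lambda>x. (t - x) powr p * ?D n g x)"
  have cont: "continuous_on {a..t} (?D k g)" if "k \<le> n" for k
    using continuous_on_nderiv_within_initial[OF g that at(2)] .
  have int1: "(\<lambda>x. (t - x) powr (p - 1) * ?D m g x) integrable_on {a..t}"
    and int0: "(\<lambda>x. (t - x) powr p * ?D n g x) integrable_on {a..t}"
    using at p Suc by (auto intro!: powr_kernel_integrable cont simp del: nderiv_within.simps)
  have "((\<lambda>x. (t - x) powr p * ?D (Suc m) g x - p * ((t - x) powr (p - 1) * ?D m g x)) has_integral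
      - ((t - a) powr p * ?D m g a)) {a..t}"
  proof (rule powr_kernel_by_parts)
    show "continuous_on {a..t} (\<lambda>x. (t - x) powr p * ?D m g x)"
      by (intro continuous_intros continuous_on_powr' cont) (use p Suc in auto)
  qed (use at Suc nderiv_within_has_derivative_at[OF g] in auto)
  moreover have "((\<lambda>x. (t - x) powr p * ?D (Suc m) g x - p * ((t - x) powr (p - 1) * ?D m g x)) has_integral
      I0 - p * I1) {a..t}"
    unfolding I0_def I1_def Suc[symmetric]
    by (intro has_integral_diff has_integral_mult_right integrable_integral int0 int1)
  ultimately have parts: "I0 - p * I1 = - ((t - a) powr p * ?D m g a)"
    by (rule has_integral_unique[rotated])
  note D = nderiv_within_linear_factor(2)[OF ab g, of _ _ t]
  have "integral {a..t} (\<lambda>x. (t - x) powr (p - 1) * ?D n (\<lambda>x. (x - t) * g x) x) =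
        integral {a..t} (\<lambda>x. real n * ((t - x) powr (p - 1) * ?D m g x) - (t - x) powr p * ?D n g x)"
  proof (rule integral_cong)
    fix x assume x: "x \<in> {a..t}"
    have "(t - x) powr (p - 1) * (x - t) = - ((t - x) powr p)"
      using x by (cases "x = t") (auto simp: powr_diff field_simps)
    then show "(t - x) powr (p - 1) * ?D n (\<lambda>x. (x - t) * g x) x =
        real n * ((t - x) powr (p - 1) * ?D m g x) - (t - x) powr p * ?D n g x"
      using D[of n x] x at Suc by (simp add: distrib_left distrib_right del: nderiv_within.simps flip: mult.assoc)
  qed
  also have "\<dots> = real n * I1 - I0"
    unfolding I0_def I1_def
    using int0 int1 by (subst integral_diff) (auto intro!: integrable_on_mult_right)
  \<comment> \<open>Integration by parts replaces \<open>I0\<close> by \<open>p * I1\<close> minus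
    the boundary term, and \<open>n - p = \<alpha>\<close>.\<close>
  also have "\<dots> = \<alpha> * I1 + (t - a) powr p * ?D m g a"
    using parts by (simp add: p_def algebra_simps)
  finally have int: "integral {a..t} (\<lambda>x. (t - x) powr (p - 1) * ?D n (\<lambda>x. (x - t) * g x) x) =
      \<alpha> * I1 + (t - a) powr p * ?D m g a" .
  have pm: "real m - (\<alpha> - 1) = p"
    using Suc by (simp add: p_def)
  have main: "RL_integral a (real n - \<alpha>) (?D n (\<lambda>x. (x - t) * g x)) t =
      \<alpha> * RL_integral a (real m - (\<alpha> - 1)) (?D m g) t + ?D m g a * ((t - a) powr p / Gamma p)"
    unfolding RL_integral_def pm p_def[symmetric] I1_def[symmetric] int
    by (simp add: add_divide_distrib mult.commute)
  have "(\<Sum>k<n. ?D k (\<lambda>x. (x - t) * g x) a * ((t - a) powr (real k - \<alpha>) / Gamma (real k + 1 - \<alpha>))) =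
      (\<Sum>k<Suc m. (- (t - a) * ?D k g a + real k * ?D (k - 1) g a) *
         ((t - a) powr (real k - \<alpha>) / Gamma (real k + 1 - \<alpha>)))"
    unfolding Suc by (rule sum.cong) (use D[of _ a] ab Suc in auto)
  also have "\<dots> = \<alpha> * (\<Sum>k<m. ?D k g a * ((t - a) powr (real k - (\<alpha> - 1)) / Gamma (real k + 1 - (\<alpha> - 1))))
         - ?D m g a * ((t - a) powr p / Gamma p)"
    unfolding p_def Suc by (rule initial_terms_linear_factor) (use at \<alpha> in auto)
  finally show ?thesis
    using main Suc by (simp add: rl_deriv_def distrib_left del: nderiv_within.simps)
qed

text \<open>Iterating the linear factor multiplies \<alpha>, \<alpha> - 1, and so on, which is
  \<open>fact j\<close> times the binomial coefficient. Once \<open>j \<ge> n\<close>, the truncated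
  \<open>n - j\<close> is \<open>0\<close> and the remaining operator is the fractional integral of
  order \<open>j - \<alpha>\<close>.\<close>

lemma rl_deriv_power_factor:
  fixes a b t \<alpha> :: real
  assumes "a < t" "t \<le> b" "\<alpha> \<notin> \<int>" "\<alpha> < real n" "n_times_cont_diff_on n {a..b} g"
  shows "rl_deriv a b n \<alpha> (\<lambda>x. (x - t) ^ j * g x) t =
           fact j * (\<alpha> gchoose j) * rl_deriv a b (n - j) (\<alpha> - real j) g t"
  using assms(3-)
proof (induction j arbitrary: n \<alpha>)
  case (Suc j)
  have "rl_deriv a b n \<alpha> (\<lambda>x. (x - t) ^ Suc j * g x) t =
        rl_deriv a b n \<alpha> (\<lambda>x. (x - t) * ((x - t) ^ j * g x)) t"
    by (simp add: mult.assoc)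
  also have "\<dots> = \<alpha> * rl_deriv a b (n - 1) (\<alpha> - 1) (\<lambda>x. (x - t) ^ j * g x) t"
    by (intro rl_deriv_linear_factor n_times_cont_diff_on_power_factor) (use assms Suc.prems in auto)
  also have "\<dots> = \<alpha> * (fact j * ((\<alpha> - 1) gchoose j) * rl_deriv a b (n - 1 - j) (\<alpha> - 1 - real j) g t)"
  proof (subst Suc.IH)
    show "\<alpha> - 1 \<notin> \<int>" using shift_non_Int Suc.prems by blast
    \<comment> \<open>For \<open>n = 0\<close> the difference \<open>n - 1\<close> stays
      \<open>0\<close>, but \<alpha> is already negative.\<close>
    show "\<alpha> - 1 < real (n - 1)" using Suc.prems by (cases n) auto
    show "n_times_cont_diff_on (n - 1) {a..b} g"
      using n_times_cont_diff_on_le Suc.prems by simp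
  qed simp
  also have "\<alpha> * (fact j * ((\<alpha> - 1) gchoose j) * rl_deriv a b (n - 1 - j) (\<alpha> - 1 - real j) g t) =
      fact (Suc j) * (\<alpha> gchoose Suc j) * rl_deriv a b (n - Suc j) (\<alpha> - real (Suc j)) g t"
  proof -
    have "fact (Suc j) * (\<alpha> gchoose Suc j) = fact j * (of_nat (Suc j) * (\<alpha> gchoose Suc j))"
      by (simp add: mult_ac del: of_nat_Suc)
    also have "\<dots> = \<alpha> * (fact j * ((\<alpha> - 1) gchoose j))"
      unfolding gbinomial_absorption by (simp add: mult_ac)
    finally show ?thesis by (simp add: diff_diff_eq mult.assoc del: fact_Suc)
  qed
  finally show ?case .
qed simp

text \<open>Each integration by parts moves one derivative from \<open>h\<close> to the kernel.
  Vanishing at \<open>t\<close> removes the boundary terms there and tames the singularity, while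
  the boundary terms at \<open>a\<close> are exactly the initial terms in
  \<open>rl_deriv\<close>.\<close>

lemma vanishing_rl_deriv_has_integral:
  fixes a b t \<alpha> :: real
  assumes at: "a < t" "t \<le> b" and "\<alpha> \<notin> \<int>" "\<alpha> < real n" "n_times_cont_diff_on n {a..b} h"
    and "\<And>k. k < n \<Longrightarrow> nderiv_within {a..b} k h t = 0"
  shows "((\<lambda>x. (t - x) powr (- \<alpha> - 1) * h x) has_integral
           Gamma (- \<alpha>) * rl_deriv a b n \<alpha> h t) {a..t}"
  using assms(3-)
proof (induction n arbitrary: h \<alpha>)
  case 0
  have "(\<lambda>x. (t - x) powr (- \<alpha> - 1) * h x) integrable_on {a..t}"
    by (rule powr_kernel_integrable)
      (use at 0 continuous_on_nderiv_within_initial[OF 0(3), of 0 t] in auto)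
  then show ?case
    using Gamma_plus1_non_Int(2)[OF shift_non_Int(3)[OF 0(1)]]
    by (simp add: rl_deriv_def RL_integral_def has_integral_iff)
next
  case (Suc n)
  let ?h' = "nderiv_within {a..b} (Suc 0) h"
  have "\<alpha> \<noteq> 0" using Suc.prems(1) by auto
  define J0 where "J0 = Gamma (- (\<alpha> - 1)) * rl_deriv a b n (\<alpha> - 1) ?h' t"
  have "((\<lambda>x. (t - x) powr (- (\<alpha> - 1) - 1) * ?h' x) has_integral J0) {a..t}"
    unfolding J0_def
  proof (rule Suc.IH)
    show "\<alpha> - 1 \<notin> \<int>" using shift_non_Int Suc.prems by blast
    show "nderiv_within {a..b} k ?h' t = 0" if "k < n" for k
      unfolding nderiv_within_Suc_shift using that Suc.prems by blast
  qed (use Suc.prems n_times_cont_diff_on_deriv in auto)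
  then have J0: "((\<lambda>x. (t - x) powr (- \<alpha>) * ?h' x) has_integral J0) {a..t}"
    by simp
  obtain C where C: "\<And>x. x \<in> {a..t} \<Longrightarrow> \<bar>h x\<bar> \<le> C * (t - x) ^ Suc n"
    using vanishing_derivatives_bound[OF at Suc.prems(3,4)] by blast
  have "((\<lambda>x. (t - x) powr (- \<alpha>) * ?h' x - - \<alpha> * ((t - x) powr (- \<alpha> - 1) * h x)) has_integral
      - ((t - a) powr (- \<alpha>) * h a)) {a..t}"
  proof (rule powr_kernel_by_parts)
    show "continuous_on {a..t} (\<lambda>x. (t - x) powr (- \<alpha>) * h x)"
      by (rule powr_kernel_continuous[OF at(1) _ C])
        (use Suc.prems at continuous_on_nderiv_within_initial[OF Suc.prems(3), of 0 t] in auto)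
  qed (use at nderiv_within_has_derivative_at[OF Suc.prems(3), of 0] in auto)
  \<comment> \<open>The integral with \<open>?h'\<close> is known by induction, so subtracting it
    yields both the existence and the value of the integral with \<open>h\<close>.\<close>
  from has_integral_diff[OF this J0]
  have "((\<lambda>x. \<alpha> * ((t - x) powr (- \<alpha> - 1) * h x)) has_integral
      - ((t - a) powr (- \<alpha>) * h a) - J0) {a..t}"
    by simp
  from has_integral_mult_right[OF this, of "1 / \<alpha>"]
  have "((\<lambda>x. (t - x) powr (- \<alpha> - 1) * h x) has_integral
      (- ((t - a) powr (- \<alpha>) * h a) - J0) / \<alpha>) {a..t}"
    using \<open>\<alpha> \<noteq> 0\<close> by simp
  moreover have "(- ((t - a) powr (- \<alpha>) * h a) - J0) / \<alpha> = Gamma (- \<alpha>) * rl_deriv a b (Suc n) \<alpha> h t"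
  proof -
    have G: "Gamma (1 - \<alpha>) = - \<alpha> * Gamma (- \<alpha>)" "Gamma (- \<alpha>) \<noteq> 0"
      using Gamma_plus1_non_Int[OF shift_non_Int(3)[OF Suc.prems(1)]] by (simp_all add: add.commute)
    \<comment> \<open>Splitting off the initial term \<open>k = 0\<close> leaves the same expression
      for \<open>?h'\<close>, with \<open>n\<close> and \<alpha> each lowered by one.\<close>
    have "rl_deriv a b (Suc n) \<alpha> h t =
        h a * ((t - a) powr (- \<alpha>) / Gamma (1 - \<alpha>)) + rl_deriv a b n (\<alpha> - 1) ?h' t"
      unfolding rl_deriv_def sum.lessThan_Suc_shift nderiv_within_Suc_shift
      by (simp add: algebra_simps del: nderiv_within.simps(2))
    then show ?thesis
      unfolding J0_def using G \<open>\<alpha> \<noteq> 0\<close> by (simp add: field_simps del: nderiv_within.simps)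
  qed
  ultimately show ?case by simp
qed

section \<open>The Taylor remainder and the Leibniz rules\<close>

text \<open>Summation by parts, as in the proof of Abel's limit theorem.\<close>

lemma power_weighted_sum_bound:
  fixes u :: "nat \<Rightarrow> real"
  assumes "\<And>m. \<bar>\<Sum>j<m. u j\<bar> \<le> B" "0 \<le> s" "s \<le> 1"
  shows "\<bar>\<Sum>j<m. u j * s ^ j\<bar> \<le> B"
proof -
  define U where "U m = (\<Sum>j<m. u j)" for m
  have U: "\<bar>U m\<bar> \<le> B" for m using assms(1) by (simp add: U_def)
  have tele: "(\<Sum>j<m. s ^ j - s ^ Suc j) = 1 - s ^ m"
    by (induction m) auto
  have "(\<Sum>j<m. u j * s ^ j) = U m * s ^ m + (\<Sum>j<m. U (Suc j) * (s ^ j - s ^ Suc j))"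
    by (induction m) (auto simp: U_def algebra_simps)
  \<comment> \<open>The weights \<open>s ^ m\<close> and \<open>s ^ j - s ^ Suc j\<close> are
    nonnegative and add up to \<open>1\<close>, so the sum is an average of the partial sums
    \<open>U\<close>.\<close>
  also have "\<bar>\<dots>\<bar> \<le> B * s ^ m + (\<Sum>j<m. B * (s ^ j - s ^ Suc j))"
  proof (rule order_trans[OF abs_triangle_ineq] add_mono)+
    show "\<bar>U m * s ^ m\<bar> \<le> B * s ^ m"
      using U assms by (simp add: abs_mult mult_right_mono)
    show "\<bar>\<Sum>j<m. U (Suc j) * (s ^ j - s ^ Suc j)\<bar> \<le> (\<Sum>j<m. B * (s ^ j - s ^ Suc j))"
    proof (rule order_trans[OF sum_abs] sum_mono)+
      fix j
      have "s ^ Suc j \<le> s ^ j" using assms by (simp add: mult_left_le_one_le)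
      then show "\<bar>U (Suc j) * (s ^ j - s ^ Suc j)\<bar> \<le> B * (s ^ j - s ^ Suc j)"
        using U[of "Suc j"] by (simp add: abs_mult mult_right_mono del: power_Suc)
    qed
  qed
  also have "\<dots> = B"
    unfolding sum_distrib_left[symmetric] tele by (simp add: algebra_simps)
  finally show ?thesis .
qed

text \<open>Convergence at \<open>a\<close>, the point farthest from \<open>t\<close>, bounds all
  partial sums there. At \<open>x\<close> the terms carry the extra factor \<open>s ^ j\<close> with
  \<open>s = (t - x) / (t - a)\<close>; from the tail \<open>s ^ N \<le> s ^ n\<close> splits off
  and Abel summation bounds the rest.\<close>

lemma taylor_remainder_bound:
  fixes a b t :: real
  assumes at: "a < t" "t \<le> b" and f: "taylor_expressible_on a b f"
  shows "\<exists>C. \<forall>N\<ge>n. \<forall>x\<in>{a..t}. \<bar>f x - taylor_poly a b N f t x\<bar> \<le> C * (t - x) ^ n"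
proof -
  define c where "c j = nderiv_within {a..b} j f t / fact j" for j
  define e where "e j = c j * (a - t) ^ j" for j
  have sums: "(\<lambda>j. c j * (x - t) ^ j) sums f x" if "x \<in> {a..t}" for x
    using f at that by (simp add: taylor_expressible_on_def c_def)
  from sums[of a] have "Bseq (\<lambda>m. \<Sum>j<m. e j)"
    unfolding sums_def e_def using at by (auto intro!: convergent_imp_Bseq convergentI)
  then obtain B where B: "\<And>m. \<bar>\<Sum>j<m. e j\<bar> \<le> B"
    by (auto simp: Bseq_def)
  \<comment> \<open>A block of the series is the difference of two partial sums, hence the factor
    \<open>2\<close>.\<close>
  have B2: "\<bar>\<Sum>j<m. e (j + N)\<bar> \<le> 2 * B" for m N
  proof -
    have "(\<Sum>j<m. e (j + N)) = (\<Sum>j<m + N. e j) - (\<Sum>j<N. e j)"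
      by (induction m) auto
    with B[of "m + N"] B[of N] show ?thesis by linarith
  qed
  have "\<bar>f x - taylor_poly a b N f t x\<bar> \<le> 2 * B / (t - a) ^ n * (t - x) ^ n"
    if x: "x \<in> {a..t}" and N: "N \<ge> n" for x N
  proof -
    define s where "s = (t - x) / (t - a)"
    have s: "0 \<le> s" "s \<le> 1" using x at by (auto simp: s_def)
    have xt: "x - t = (a - t) * s" using at by (simp add: s_def field_simps)
    have partial: "\<bar>\<Sum>j<m. c (j + N) * (x - t) ^ (j + N)\<bar> \<le> s ^ n * (2 * B)" for m
    proof -
      have "(\<Sum>j<m. c (j + N) * (x - t) ^ (j + N)) = s ^ N * (\<Sum>j<m. e (j + N) * s ^ j)"
        unfolding xt e_def sum_distrib_left
        by (rule sum.cong) (auto simp: power_mult_distrib power_add)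
      also have "\<bar>\<dots>\<bar> \<le> s ^ n * (2 * B)"
        unfolding abs_mult
        using power_weighted_sum_bound[of "\<lambda>j. e (j + N)", OF B2 s] s N
        by (intro mult_mono) (auto intro: power_decreasing)
      finally show ?thesis .
    qed
    have "(\<lambda>j. c (j + N) * (x - t) ^ (j + N)) sums (f x - taylor_poly a b N f t x)"
      unfolding taylor_poly_def c_def[symmetric]
      by (rule sums_split_initial_segment[OF sums[OF x]])
    then have "(\<lambda>m. \<bar>\<Sum>j<m. c (j + N) * (x - t) ^ (j + N)\<bar>)
        \<longlonglongrightarrow> \<bar>f x - taylor_poly a b N f t x\<bar>"
      unfolding sums_def by (rule tendsto_rabs)
    then have "\<bar>f x - taylor_poly a b N f t x\<bar> \<le> s ^ n * (2 * B)"
      by (rule LIMSEQ_le_const2) (use partial in auto)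
    then show ?thesis
      by (simp add: s_def power_divide mult_ac)
  qed
  then show ?thesis by blast
qed

lemma rl_deriv_taylor_remainder:
  fixes a b t :: real
  assumes at: "a < t" "t \<le> b" and \<alpha>: "\<alpha> \<notin> \<int>" "\<alpha> < real n"
    and f: "taylor_expressible_on a b f" and g: "n_times_cont_diff_on n {a..b} g"
  shows "(\<lambda>N. rl_deriv a b n \<alpha> (\<lambda>x. (f x - taylor_poly a b N f t x) * g x) t) \<longlonglongrightarrow> 0"
proof -
  have ab: "a < b" and t: "t \<in> {a..b}" using at by auto
  define r where "r N x = (f x - taylor_poly a b N f t x) * g x" for N x
  \<comment> \<open>The shift by \<open>n\<close> gives the Taylor polynomial at least
    \<open>n\<close> terms, so all derivatives of the remainder of order below \<open>n\<close>
    vanish at \<open>t\<close>.\<close>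
  have int: "((\<lambda>x. (t - x) powr (- \<alpha> - 1) * r (N + n) x) has_integral
      Gamma (- \<alpha>) * rl_deriv a b n \<alpha> (r (N + n)) t) {a..t}" for N
  proof (rule vanishing_rl_deriv_has_integral[OF at \<alpha>])
    define q where "q x = - 1 * taylor_poly a b (N + n) f t x + f x" for x
    have fn: "n_times_cont_diff_on n {a..b} f"
      using f infinitely_diff_on_imp_n_times by (simp add: taylor_expressible_on_def)
    note T = nderiv_within_taylor_poly[OF ab, where N = "N + n" and f = f and t = t]
    have q: "n_times_cont_diff_on n {a..b} q"
      unfolding q_def by (rule nderiv_within_lincomb(1)[OF ab T(1) fn])
    have q0: "nderiv_within {a..b} k q t = 0" if "k < n" for k
      unfolding q_def using nderiv_within_lincomb(2)[OF ab T(1) fn, of k t "- 1"] T(2)[of k] that t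
      by simp
    have r: "r (N + n) = (\<lambda>x. q x * g x)" by (auto simp: r_def q_def)
    show "n_times_cont_diff_on n {a..b} (r (N + n))"
      unfolding r by (rule nderiv_within_mult(1)[OF ab q g])
    show "nderiv_within {a..b} k (r (N + n)) t = 0" if "k < n" for k
      unfolding r using nderiv_within_mult(2)[OF ab q g, of k t] that t q0 by simp
  qed
  obtain C where C: "\<bar>f x - taylor_poly a b N f t x\<bar> \<le> C * (t - x) ^ n"
    if "N \<ge> n" "x \<in> {a..t}" for N x
    using taylor_remainder_bound[OF at f, of n] by blast
  have contg: "continuous_on {a..t} g"
    using continuous_on_nderiv_within_initial[OF g, of 0 t] at by simp
  have "(\<lambda>N. integral {a..t} (\<lambda>x. (t - x) powr (- \<alpha> - 1) * r (N + n) x))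
      \<longlonglongrightarrow> integral {a..t} (\<lambda>x. 0)"
  proof (rule dominated_convergence(2))
    show "(\<lambda>x. (t - x) powr (- \<alpha> - 1) * r (N + n) x) integrable_on {a..t}" for N
      using int by (rule has_integral_integrable)
    \<comment> \<open>The bound \<open>C * (t - x) ^ n\<close> raises the kernel exponent to
      \<open>n - \<alpha> - 1\<close>, which exceeds \<open>-1\<close>; hence the majorant is
      integrable.\<close>
    show "(\<lambda>x. (t - x) powr (real n - \<alpha> - 1) * (C * \<bar>g x\<bar>)) integrable_on {a..t}"
      by (rule powr_kernel_integrable) (use at \<alpha> contg in \<open>auto intro!: continuous_intros\<close>)
    fix x assume x: "x \<in> {a..t}"
    show "norm ((t - x) powr (- \<alpha> - 1) * r (N + n) x) \<le>
        (t - x) powr (real n - \<alpha> - 1) * (C * \<bar>g x\<bar>)" for N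
    proof (cases "x = t")
      case False
      then have "(t - x) powr (real n - \<alpha> - 1) = (t - x) powr (- \<alpha> - 1) * (t - x) ^ n"
        using x powr_add[of "t - x" "- \<alpha> - 1" "real n"] by (simp add: powr_realpow algebra_simps)
      moreover have "\<bar>r (N + n) x\<bar> \<le> (C * (t - x) ^ n) * \<bar>g x\<bar>"
        unfolding r_def abs_mult by (intro mult_right_mono C) (use x in auto)
      then have "(t - x) powr (- \<alpha> - 1) * \<bar>r (N + n) x\<bar> \<le>
          (t - x) powr (- \<alpha> - 1) * ((C * (t - x) ^ n) * \<bar>g x\<bar>)"
        by (intro mult_left_mono) auto
      ultimately show ?thesis by (simp add: abs_mult mult_ac)
    qed simp
    have "(\<lambda>N. taylor_poly a b N f t x) \<longlonglongrightarrow> f x"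
      using f x at by (simp add: taylor_expressible_on_def taylor_poly_def sums_def)
    then have "(\<lambda>N. taylor_poly a b (N + n) f t x) \<longlonglongrightarrow> f x"
      by (rule LIMSEQ_ignore_initial_segment)
    then have "(\<lambda>N. (t - x) powr (- \<alpha> - 1) * r (N + n) x)
        \<longlonglongrightarrow> (t - x) powr (- \<alpha> - 1) * ((f x - f x) * g x)"
      unfolding r_def by (intro tendsto_intros)
    then show "(\<lambda>N. (t - x) powr (- \<alpha> - 1) * r (N + n) x) \<longlonglongrightarrow> 0" by simp
  qed
  then have "(\<lambda>N. Gamma (- \<alpha>) * rl_deriv a b n \<alpha> (r (N + n)) t) \<longlonglongrightarrow> 0"
    using integral_unique[OF int] by simp
  then have "(\<lambda>N. Gamma (- \<alpha>) * rl_deriv a b n \<alpha> (r (N + n)) t / Gamma (- \<alpha>)) \<longlonglongrightarrow> 0 / Gamma (- \<alpha>)"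
    using Gamma_plus1_non_Int(2)[OF shift_non_Int(3)[OF \<alpha>(1)]] by (intro tendsto_divide) auto
  then have "(\<lambda>N. rl_deriv a b n \<alpha> (r (N + n)) t) \<longlonglongrightarrow> 0"
    using Gamma_plus1_non_Int(2)[OF shift_non_Int(3)[OF \<alpha>(1)]] by simp
  then show ?thesis
    unfolding r_def by (rule LIMSEQ_offset)
qed

text \<open>Passing from the remainder \<open>r N\<close> to \<open>r (Suc N)\<close> removes one
  Taylor term, whose contribution is \<open>w N\<close>. The partial sums therefore telescope, and
  convergence and value of the series both follow from the vanishing limit.\<close>

lemma rl_deriv_leibniz_sums:
  fixes a b t :: real
  assumes at: "a < t" "t \<le> b" and \<alpha>: "\<alpha> \<notin> \<int>" "\<alpha> < real n"
    and f: "taylor_expressible_on a b f" and g: "n_times_cont_diff_on n {a..b} g"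
  shows "(\<lambda>j. (\<alpha> gchoose j) * nderiv_within {a..b} j f t * rl_deriv a b (n - j) (\<alpha> - real j) g t)
           sums rl_deriv a b n \<alpha> (\<lambda>x. f x * g x) t"
proof -
  have ab: "a < b" using at by simp
  define r where "r N x = (f x - taylor_poly a b N f t x) * g x" for N x
  define w where
    "w j = (\<alpha> gchoose j) * nderiv_within {a..b} j f t * rl_deriv a b (n - j) (\<alpha> - real j) g t" for j
  have fn: "n_times_cont_diff_on n {a..b} f"
    using f infinitely_diff_on_imp_n_times by (simp add: taylor_expressible_on_def)
  have r: "n_times_cont_diff_on n {a..b} (r N)" for N
    using nderiv_within_mult(1)[OF ab
        nderiv_within_lincomb(1)[OF ab nderiv_within_taylor_poly(1)[OF ab] fn, of "- 1" N f t] g]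
    by (simp add: r_def[abs_def] algebra_simps)
  have step: "rl_deriv a b n \<alpha> (r N) t = w N + rl_deriv a b n \<alpha> (r (Suc N)) t" for N
  proof -
    have rN: "r N = (\<lambda>x. nderiv_within {a..b} N f t / fact N * ((x - t) ^ N * g x) + r (Suc N) x)"
      by (auto simp: r_def taylor_poly_def algebra_simps)
    have "rl_deriv a b n \<alpha> (r N) t =
        nderiv_within {a..b} N f t / fact N * rl_deriv a b n \<alpha> (\<lambda>x. (x - t) ^ N * g x) t
        + rl_deriv a b n \<alpha> (r (Suc N)) t"
      unfolding rN by (rule rl_deriv_lincomb[OF at \<alpha>(2) n_times_cont_diff_on_power_factor[OF ab g] r])
    then show ?thesis
      by (simp add: rl_deriv_power_factor[OF at \<alpha> g] w_def)
  qed
  have partial: "(\<Sum>j<N. w j) = rl_deriv a b n \<alpha> (r 0) t - rl_deriv a b n \<alpha> (r N) t" for N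
  proof (induction N)
    case (Suc N)
    then show ?case using step[of N] by simp
  qed simp
  have "(\<lambda>N. \<Sum>j<N. w j) \<longlonglongrightarrow> rl_deriv a b n \<alpha> (r 0) t - 0"
    unfolding partial using rl_deriv_taylor_remainder[OF assms]
    by (intro tendsto_diff tendsto_const) (simp add: r_def[abs_def])
  moreover have "r 0 = (\<lambda>x. f x * g x)"
    by (auto simp: r_def taylor_poly_def)
  ultimately show ?thesis
    by (simp add: sums_def w_def)
qed

section \<open>Return to the Caputo derivative\<close>

lemma caputo_eq_rl_deriv:
  fixes a b t :: real
  assumes "real n - 1 < \<alpha>" "\<alpha> < real n"
  shows "caputo a b (\<alpha> - real j) g t = rl_deriv a b (n - j) (\<alpha> - real j) g t -
    (\<Sum>i<n - j. nderiv_within {a..b} i g a *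
       ((t - a) powr (real (j + i) - \<alpha>) / Gamma (real (j + i) + 1 - \<alpha>)))"
proof -
  have "caputo a b (\<alpha> - real j) g t =
      RL_integral a (real (n - j) - (\<alpha> - real j)) (nderiv_within {a..b} (n - j) g) t"
  \<comment> \<open>The truncated \<open>n - j\<close> covers both branches of
    \<open>caputo\<close>: it is the ceiling of the order for \<open>j < n\<close>, and
    \<open>0\<close> for \<open>j \<ge> n\<close>, where the order is negative.\<close>
  proof (cases "j < n")
    case True
    then have "\<lceil>\<alpha> - real j\<rceil> = int (n - j)"
      using assms by (intro ceiling_unique) auto
    moreover have "\<not> \<alpha> - real j < 0" using True assms by linarith
    ultimately show ?thesis by (simp add: caputo_def Let_def)
  qed (use assms in \<open>auto simp: caputo_def\<close>)
  then show ?thesis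
    by (simp add: rl_deriv_def algebra_simps)
qed

text \<open>Subtracting initial terms from both sides of the remainder-free rule leaves their
  difference as the correction. Those of the series carry \<open>\<alpha> gchoose j\<close> and
  derivatives of \<open>f\<close> at \<open>t\<close>; those of the product, expanded by the
  ordinary Leibniz rule, carry \<open>k choose j\<close> and derivatives at
  \<open>a\<close>.\<close>

lemma caputo_leibniz:
  fixes a b t :: real
  assumes at: "a < t" "t \<le> b" and n: "real n - 1 < \<alpha>" "\<alpha> < real n"
    and f: "taylor_expressible_on a b f" and g: "n_times_cont_diff_on n {a..b} g"
  shows "(\<lambda>j. (\<alpha> gchoose j) * nderiv_within {a..b} j f t * caputo a b (\<alpha> - real j) g t)
           sums (caputo a b \<alpha> (\<lambda>x. f x * g x) t - leibniz_remainder a b n \<alpha> f g t)"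
proof -
  let ?D = "nderiv_within {a..b}"
  define P where "P k = (t - a) powr (real k - \<alpha>) / Gamma (real k + 1 - \<alpha>)" for k
  define A where "A j = (\<alpha> gchoose j) * ?D j f t" for j
  have ab: "a < b" using at by simp
  have "\<alpha> \<notin> \<int>"
  proof
    assume "\<alpha> \<in> \<int>"
    then obtain z where "\<alpha> = of_int z" by (elim Ints_cases)
    with n have "real_of_int (int n - 1) < of_int z" "real_of_int z < of_int (int n)" by simp_all
    then show False unfolding of_int_less_iff by linarith
  qed
  note sums = rl_deriv_leibniz_sums[OF at this n(2) f g]
  have fn: "n_times_cont_diff_on n {a..b} f"
    using f infinitely_diff_on_imp_n_times by (simp add: taylor_expressible_on_def)
  \<comment> \<open>For \<open>j \<ge> n\<close> the inner sum is empty, so this series is finite.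
    Regrouping by \<open>k = j + i\<close> then collects equal powers of
    \<open>t - a\<close>.\<close>
  have "(\<lambda>j. A j * (\<Sum>i<n - j. ?D i g a * P (j + i))) sums
      (\<Sum>j<n. A j * (\<Sum>i<n - j. ?D i g a * P (j + i)))"
    by (rule sums_finite) auto
  also have "(\<Sum>j<n. A j * (\<Sum>i<n - j. ?D i g a * P (j + i))) =
      (\<Sum>(j, i)\<in>{(j, i). j + i < n}. A j * (?D i g a * P (j + i)))"
  proof -
    have "{(j, i). j + i < n} = (SIGMA j:{..<n}. {..<n - j})" by auto
    then show ?thesis by (simp add: sum_distrib_left sum.Sigma)
  qed
  also have "\<dots> = (\<Sum>k<n. \<Sum>j\<le>k. A j * (?D (k - j) g a * P k))"
    by (subst sum.triangle_reindex) simp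
  finally have "(\<lambda>j. A j * rl_deriv a b (n - j) (\<alpha> - real j) g t
        - A j * (\<Sum>i<n - j. ?D i g a * P (j + i))) sums
      (rl_deriv a b n \<alpha> (\<lambda>x. f x * g x) t - (\<Sum>k<n. \<Sum>j\<le>k. A j * (?D (k - j) g a * P k)))"
    using sums unfolding A_def by (intro sums_diff)
  moreover have "A j * rl_deriv a b (n - j) (\<alpha> - real j) g t
        - A j * (\<Sum>i<n - j. ?D i g a * P (j + i)) = A j * caputo a b (\<alpha> - real j) g t" for j
    unfolding caputo_eq_rl_deriv[OF n] P_def by (simp only: right_diff_distrib)
  moreover have "rl_deriv a b n \<alpha> (\<lambda>x. f x * g x) t - (\<Sum>k<n. \<Sum>j\<le>k. A j * (?D (k - j) g a * P k))
      = caputo a b \<alpha> (\<lambda>x. f x * g x) t - leibniz_remainder a b n \<alpha> f g t"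
  proof -
    have "caputo a b \<alpha> (\<lambda>x. f x * g x) t =
        rl_deriv a b n \<alpha> (\<lambda>x. f x * g x) t - (\<Sum>k<n. ?D k (\<lambda>x. f x * g x) a * P k)"
      using caputo_eq_rl_deriv[OF n, of a b 0 "\<lambda>x. f x * g x" t] by (simp add: P_def)
    moreover have "(\<Sum>k<n. ?D k (\<lambda>x. f x * g x) a * P k) =
        (\<Sum>k<n. \<Sum>j\<le>k. real (k choose j) * ?D j f a * (?D (k - j) g a * P k))"
    proof (rule sum.cong)
      fix k assume "k \<in> {..<n}"
      then show "?D k (\<lambda>x. f x * g x) a * P k =
          (\<Sum>j\<le>k. real (k choose j) * ?D j f a * (?D (k - j) g a * P k))"
        using nderiv_within_mult(2)[OF ab fn g, of k a] ab by (simp add: sum_distrib_right mult.assoc)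
    qed simp
    moreover have "leibniz_remainder a b n \<alpha> f g t =
        (\<Sum>k<n. \<Sum>j\<le>k. A j * (?D (k - j) g a * P k)) -
        (\<Sum>k<n. \<Sum>j\<le>k. real (k choose j) * ?D j f a * (?D (k - j) g a * P k))"
      unfolding leibniz_remainder_def A_def P_def sum_subtractf[symmetric]
      by (intro sum.cong) (simp_all add: algebra_simps diff_divide_distrib)
    ultimately show ?thesis by simp
  qed
  ultimately show ?thesis by (simp add: A_def)
qed

theorem theorem3p4:
  fixes n :: nat and \<alpha> a b :: real and f g :: "real \<Rightarrow> real"
  assumes "n \<ge> 1" and "real n - 1 < \<alpha>" and "\<alpha> < real n" and "a < b"
  shows
    "(taylor_expressible_on a b f \<and> n_times_cont_diff_on n {a..b} g \<longrightarrow>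
        (\<forall>t\<in>{a<..b}.
           summable (\<lambda>j. (\<alpha> gchoose j) * nderiv_within {a..b} j f t * caputo a b (\<alpha> - real j) g t) \<and>
           caputo a b \<alpha> (\<lambda>\<tau>. f \<tau> * g \<tau>) t =
             (\<Sum>j. (\<alpha> gchoose j) * nderiv_within {a..b} j f t * caputo a b (\<alpha> - real j) g t)
             + leibniz_remainder a b n \<alpha> f g t)) \<and>
     (taylor_expressible_on a b g \<and> n_times_cont_diff_on n {a..b} f \<longrightarrow>
        (\<forall>t\<in>{a<..b}.
           summable (\<lambda>j. (\<alpha> gchoose j) * nderiv_within {a..b} j g t * caputo a b (\<alpha> - real j) f t) \<and>
           caputo a b \<alpha> (\<lambda>\<tau>. f \<tau> * g \<tau>) t =
             (\<Sum>j. (\<alpha> gchoose j) * nderiv_within {a..b} j g t * caputo a b (\<alpha> - real j) f t)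
             + leibniz_remainder a b n \<alpha> g f t))"
proof -
  have half: "summable (\<lambda>j. (\<alpha> gchoose j) * nderiv_within {a..b} j u t * caputo a b (\<alpha> - real j) v t) \<and>
      caputo a b \<alpha> (\<lambda>\<tau>. u \<tau> * v \<tau>) t =
        (\<Sum>j. (\<alpha> gchoose j) * nderiv_within {a..b} j u t * caputo a b (\<alpha> - real j) v t)
        + leibniz_remainder a b n \<alpha> u v t"
    if "taylor_expressible_on a b u" "n_times_cont_diff_on n {a..b} v" "t \<in> {a<..b}" for u v t
    using caputo_leibniz[OF _ _ assms(2,3) that(1,2), of t] that(3) by (auto simp: sums_iff)
  have comm: "(\<lambda>\<tau>. f \<tau> * g \<tau>) = (\<lambda>\<tau>. g \<tau> * f \<tau>)"
    by (simp add: mult.commute)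
  show ?thesis
  proof (intro conjI[where P = "A \<longrightarrow> B" for A B] impI ballI; elim conjE)
    fix t assume "taylor_expressible_on a b f" "n_times_cont_diff_on n {a..b} g" "t \<in> {a<..b}"
    from half[OF this] show "summable (\<lambda>j. (\<alpha> gchoose j) * nderiv_within {a..b} j f t * caputo a b (\<alpha> - real j) g t) \<and>
           caputo a b \<alpha> (\<lambda>\<tau>. f \<tau> * g \<tau>) t =
             (\<Sum>j. (\<alpha> gchoose j) * nderiv_within {a..b} j f t * caputo a b (\<alpha> - real j) g t)
             + leibniz_remainder a b n \<alpha> f g t" .
  next
    fix t assume "taylor_expressible_on a b g" "n_times_cont_diff_on n {a..b} f" "t \<in> {a<..b}"
    from half[OF this] show "summable (\<lambda>j. (\<alpha> gchoose j) * nderiv_within {a..b} j g t * caputo a b (\<alpha> - real j) f t) \<and>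
           caputo a b \<alpha> (\<lambda>\<tau>. f \<tau> * g \<tau>) t =
             (\<Sum>j. (\<alpha> gchoose j) * nderiv_within {a..b} j g t * caputo a b (\<alpha> - real j) f t)
             + leibniz_remainder a b n \<alpha> g f t"
      unfolding comm .
  qed
qed

end
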